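(* Suppose that the Simultaneous Positivity Problem is decidable for rational linear recurrence sequences. Then for every $\lambda \in \mathbb{Q}(i)$ with $|\lambda| = 1$, the real number $L(\arg\lambda/2\pi)$ is computable.
   Context: The Simultaneous Positivity Problem for rational linear recurrence sequences: given linear recurrence sequences $\mathcal{S}_1,\dots,\mathcal{S}_k$ with rational recurrence coefficients and rational initial terms, all satisfying a common recurrence equation, decide whether there exists $n\in\mathbb{N}$ with $\mathcal{S}_j(n)\ge 0$ for all $j$. For a real number $x$, its homogeneous Diophantine approximation type is $L(x) = \inf\{c \in \mathbb{R} : \exists n, m \in \mathbb{Z},\ m\neq 0,\ |x - n/m| < c/m^2\}$. A real number $x$ is computable if there is an algorithm which, given any rational $\varepsilon > 0$, outputs a rational $q$ with $|q - x| < \varepsilon$. *)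

theory Defs
  imports "HOL-Analysis.Analysis" "HOL-Library.Nat_Bijection" "HOL-Library.Countable"
begin

text \<open>
  \<open>recursive n f\<close>: \<open>f\<close> is a total general recursive function of \<open>n\<close> arguments in Kleene's sense.
  The arguments form a list of length \<open>n\<close>; rule \<open>ext\<close> makes the values of \<open>f\<close> on lists of
  any other length irrelevant. By Kleene's normal form theorem, minimization of regular
  functions suffices to obtain all total computable functions.
\<close>

inductive recursive :: "nat \<Rightarrow> (nat list \<Rightarrow> nat) \<Rightarrow> bool" where
  zero: "recursive n (\<lambda>xs. 0)"
| succ: "recursive 1 (\<lambda>xs. Suc (xs ! 0))"
| proj: "i < n \<Longrightarrow> recursive n (\<lambda>xs. xs ! i)"
| comp: "recursive (length gs) f \<Longrightarrow> (\<forall>g\<in>set gs. recursive n g) \<Longrightarrow>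
    recursive n (\<lambda>xs. f (map (\<lambda>g. g xs) gs))"
| prim_rec: "recursive n f \<Longrightarrow> recursive (n + 2) g \<Longrightarrow>
    recursive (n + 1) (\<lambda>xs. rec_nat (f (tl xs)) (\<lambda>y r. g (y # r # tl xs)) (hd xs))"
| minimize: "recursive (n + 1) f \<Longrightarrow> (\<forall>xs. length xs = n \<longrightarrow> (\<exists>y. f (y # xs) = 0)) \<Longrightarrow>
    recursive n (\<lambda>xs. LEAST y. f (y # xs) = 0)"
| ext: "recursive n f \<Longrightarrow> (\<forall>xs. length xs = n \<longrightarrow> g xs = f xs) \<Longrightarrow> recursive n g"

text \<open>
  A rational is presented to an algorithm, and returned by it, as a code under the surjection
  \<open>nat_to_rat_surj\<close> (numerator and denominator, not necessarily in lowest terms).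
\<close>

definition computable_real :: "real \<Rightarrow> bool" where
  "computable_real x \<longleftrightarrow>
    (\<exists>f. recursive 1 f \<and>
      (\<forall>e. nat_to_rat_surj e > 0 \<longrightarrow>
        \<bar>of_rat (nat_to_rat_surj (f [e])) - x\<bar> < of_rat (nat_to_rat_surj e)))"

text \<open>
  \<open>lrs cs init\<close> is the sequence \<open>u\<close> with \<open>u n = (\<Sum>j=1..k. a\<^sub>j * u (n - j))\<close> for \<open>n \<ge> k\<close>, where
  \<open>cs = [a\<^sub>1, \<dots>, a\<^sub>k]\<close> and \<open>init = [u 0, \<dots>, u (k - 1)]\<close>.
\<close>

function lrs :: "rat list \<Rightarrow> rat list \<Rightarrow> nat \<Rightarrow> rat" where
  "lrs cs init n =
    (if n < length cs then init ! n
     else (\<Sum>i<length cs. cs ! i * lrs cs init (n - Suc i)))"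
  by auto
termination
  by (relation "Wellfounded.measure (\<lambda>(cs, init, n). n)") auto

declare lrs.simps [simp del]

lemma lrs_initial: "n < length cs \<Longrightarrow> lrs cs init n = init ! n"
  by (subst lrs.simps) simp

lemma lrs_recurrence:
  "lrs cs init (n + length cs) =
    (\<Sum>i<length cs. cs ! i * lrs cs init (n + length cs - Suc i))"
  by (subst lrs.simps) simp

text \<open>
  An instance of the Simultaneous Positivity Problem consists of the coefficients of the common
  recurrence and, for each of the sequences, the list of its initial terms.
\<close>

type_synonym spp_instance = "rat list \<times> rat list list"

definition spp_wf :: "spp_instance \<Rightarrow> bool" where
  "spp_wf = (\<lambda>(cs, inits). cs \<noteq> [] \<and> inits \<noteq> [] \<and> (\<forall>init\<in>set inits. length init = length cs))"

definition spp_yes :: "spp_instance \<Rightarrow> bool" where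
  "spp_yes = (\<lambda>(cs, inits). \<exists>n. \<forall>init\<in>set inits. lrs cs init n \<ge> 0)"

definition decode_rats :: "nat \<Rightarrow> rat list" where
  "decode_rats c = map nat_to_rat_surj (list_decode c)"

definition spp_decode :: "nat \<Rightarrow> spp_instance" where
  "spp_decode c = (case prod_decode c of (a, b) \<Rightarrow> (decode_rats a, map decode_rats (list_decode b)))"

lemma surj_spp_decode: "surj spp_decode"
proof -
  have rats: "surj decode_rats"
  proof (rule surjI)
    fix qs
    show "decode_rats (list_encode (map (inv nat_to_rat_surj) qs)) = qs"
      by (simp add: decode_rats_def surj_iff [THEN iffD1, OF surj_nat_to_rat_surj])
  qed
  show ?thesis
  proof (rule surjI)
    fix I
    show "spp_decode ((\<lambda>(cs, inits). prod_encode
        (inv decode_rats cs, list_encode (map (inv decode_rats) inits))) I) = I"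
      by (cases I) (simp add: spp_decode_def surj_f_inv_f [OF rats] surj_iff [THEN iffD1, OF rats])
  qed
qed

definition simultaneous_positivity_decidable :: bool where
  "simultaneous_positivity_decidable \<longleftrightarrow>
    (\<exists>f. recursive 1 f \<and>
      (\<forall>c. spp_wf (spp_decode c) \<longrightarrow> f [c] = (if spp_yes (spp_decode c) then 1 else 0)))"

definition gaussian_rationals :: "complex set" where
  "gaussian_rationals = {of_rat a + \<i> * of_rat b | a b. True}"

definition dioph_type :: "real \<Rightarrow> real" where
  "dioph_type x =
    Inf {c. \<exists>n m :: int. m \<noteq> 0 \<and> \<bar>x - of_int n / of_int m\<bar> < c / (of_int m)\<^sup>2}"

end

theory Submission
  imports Defs
begin

text \<open>
  Let \<open>L\<close> be the infimum of the values \<open>m \<bar>m x - k\<bar>\<close> over \<open>m \<ge> 1\<close> and integers \<open>k\<close>, where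
  \<open>x = \<theta> / 2\<pi>\<close> is the normalised angle of \<open>z\<close>. Computability of a real is a nonuniform notion, so
  one may distinguish whether the infimum is attained. If it is, \<open>L\<close> is obtained from \<open>x\<close> by integer
  arithmetic, and \<open>\<lfloor>n x\<rfloor>\<close> is the number of completed turns among the first powers of \<open>z\<close>,
  read off from the signs of the imaginary parts.
  If it is not attained, every tail of the values has infimum \<open>L\<close> and \<open>tan \<phi> / \<phi>\<close> tends to \<open>1\<close> from above
  as \<open>\<phi>\<close> tends to \<open>0\<close>; hence for \<open>C \<ge> 0\<close> there is some \<open>m \<ge> 1\<close> with
  \<open>\<plusminus> m sin m\<theta> \<le> C cos m\<theta>\<close> if and only if \<open>C > 2\<pi>L\<close>. For rational \<open>C\<close> this is an instance of
  Simultaneous Positivity, which yields the Dedekind cut of \<open>2\<pi>L\<close>; dividing by \<open>2\<pi>\<close> gives \<open>L\<close>.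
\<close>

subsection \<open>Closure properties of recursive functions\<close>

lemma recursive_cong:
  assumes "recursive n f" "\<And>xs. length xs = n \<Longrightarrow> g xs = f xs"
  shows "recursive n g"
  using recursive.ext[OF assms(1)] assms(2) by blast

lemma recursive_nth: "i < n \<Longrightarrow> recursive n (\<lambda>xs. xs ! i)"
  by (rule recursive.proj)

lemma recursive_comp1:
  assumes "recursive 1 f" "recursive n a"
  shows "recursive n (\<lambda>xs. f [a xs])"
  using recursive.comp[of "[a]" f n] assms by simp

lemma recursive_comp2:
  assumes "recursive 2 f" "recursive n a" "recursive n b"
  shows "recursive n (\<lambda>xs. f [a xs, b xs])"
  using recursive.comp[of "[a, b]" f n] assms by (simp add: numeral_2_eq_2)

text \<open>Weakening: recursion and minimization put new variables in front of the argument list,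
  and the ambient functions must skip them.\<close>

lemma recursive_drop:
  assumes "recursive n f"
  shows "recursive (k + n) (\<lambda>xs. f (drop k xs))"
proof -
  have "recursive (k + n) (\<lambda>xs. f (map (\<lambda>g. g xs) (map (\<lambda>i xs. xs ! (k + i)) [0..<n])))"
    using assms by (intro recursive.comp) (auto intro: recursive_nth)
  then show ?thesis
  proof (rule recursive_cong)
    fix xs :: "nat list" assume "length xs = k + n"
    then have "drop k xs = map (\<lambda>g. g xs) (map (\<lambda>i xs. xs ! (k + i)) [0..<n])"
      by (intro nth_equalityI) auto
    then show "f (drop k xs) = f (map (\<lambda>g. g xs) (map (\<lambda>i xs. xs ! (k + i)) [0..<n]))"
      by simp
  qed
qed

lemma recursive_tl: "recursive n f \<Longrightarrow> recursive (Suc n) (\<lambda>xs. f (tl xs))"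
  using recursive_drop[of n f 1] by (simp add: drop_Suc)

lemma recursive_tl_tl: "recursive n f \<Longrightarrow> recursive (Suc (Suc n)) (\<lambda>xs. f (tl (tl xs)))"
  by (rule recursive_tl[where f = "\<lambda>xs. f (tl xs)"], rule recursive_tl)

lemma recursive_Suc: "recursive n a \<Longrightarrow> recursive n (\<lambda>xs. Suc (a xs))"
  using recursive_comp1[OF recursive.succ] by simp

lemma recursive_const: "recursive n (\<lambda>xs. c)"
  by (induction c) (auto intro: recursive.zero recursive_Suc)

text \<open>\<open>recursive.prim_rec\<close> recurses on the head of the argument list. Composing
  it with \<open>b\<close> followed by all projections allows any recursive bound, while base and
  step still see the full list \<open>xs\<close>.\<close>

lemma recursive_rec_nat:
  assumes f: "recursive n f" and g: "recursive (Suc (Suc n)) (\<lambda>ys. g (ys ! 0) (ys ! 1) (tl (tl ys)))"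
    and b: "recursive n b"
  shows "recursive n (\<lambda>xs. rec_nat (f xs) (\<lambda>y r. g y r xs) (b xs))"
proof -
  have r: "recursive (length (b # map (\<lambda>i xs. xs ! i) [0..<n]))
      (\<lambda>xs. rec_nat (f (tl xs)) (\<lambda>y r. g y r (tl xs)) (hd xs))"
    using recursive.prim_rec[of n f "\<lambda>ys. g (ys ! 0) (ys ! 1) (tl (tl ys))"] f g by simp
  show ?thesis
    by (rule recursive_cong[OF recursive.comp[OF r, of n]])
      (auto intro: b recursive_nth simp: comp_def map_nth[symmetric] nth_equalityI
        intro!: arg_cong2[where f = "\<lambda>xs ys. rec_nat (f xs) (\<lambda>y r. g y r ys) (b _)"])
qed

lemma recursive_add:
  assumes "recursive n a" "recursive n b"
  shows "recursive n (\<lambda>xs. a xs + b xs)"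
proof (rule recursive_cong)
  show "recursive n (\<lambda>xs. rec_nat (a xs) (\<lambda>y r. Suc r) (b xs))"
    by (intro recursive_rec_nat assms recursive_Suc recursive_nth) simp
  have "m + k = rec_nat m (\<lambda>y r. Suc r) k" for m k :: nat
    by (induction k) auto
  then show "a xs + b xs = rec_nat (a xs) (\<lambda>y r. Suc r) (b xs)" for xs .
qed

lemma recursive_mult:
  assumes "recursive n a" "recursive n b"
  shows "recursive n (\<lambda>xs. a xs * b xs)"
proof (rule recursive_cong)
  show "recursive n (\<lambda>xs. rec_nat 0 (\<lambda>y r. a xs + r) (b xs))"
    by (intro recursive_rec_nat assms recursive_add recursive_const recursive_nth recursive_tl_tl) simp
  have "m * k = rec_nat 0 (\<lambda>y r. m + r) k" for m k :: nat
    by (induction k) auto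
  then show "a xs * b xs = rec_nat 0 (\<lambda>y r. a xs + r) (b xs)" for xs .
qed

lemma recursive_diff:
  assumes "recursive n a" "recursive n b"
  shows "recursive n (\<lambda>xs. a xs - b xs)"
proof (rule recursive_cong)
  \<comment> \<open>Predecessor is a recursion that returns the step index and discards the
    accumulator; iterating it gives truncated subtraction.\<close>
  have pred: "recursive m (\<lambda>xs. c xs - 1)" if "recursive m c" for m c
  proof (rule recursive_cong)
    show "recursive m (\<lambda>xs. rec_nat 0 (\<lambda>y r. y) (c xs))"
      by (intro recursive_rec_nat that recursive_const recursive_nth) simp
    show "c xs - 1 = rec_nat 0 (\<lambda>y r. y) (c xs)" for xs
      by (cases "c xs") auto
  qed
  show "recursive n (\<lambda>xs. rec_nat (a xs) (\<lambda>y r. r - 1) (b xs))"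
    by (intro recursive_rec_nat assms pred recursive_nth) simp
  have "m - k = rec_nat m (\<lambda>y r. r - 1) k" for m k :: nat
    by (induction k) auto
  then show "a xs - b xs = rec_nat (a xs) (\<lambda>y r. r - 1) (b xs)" for xs .
qed

lemma recursive_sum:
  assumes g: "recursive (Suc n) (\<lambda>ys. g (ys ! 0) (tl ys))" and b: "recursive n b"
  shows "recursive n (\<lambda>xs. \<Sum>i<b xs. g i xs)"
proof (rule recursive_cong)
  \<comment> \<open>The recursion step receives index, accumulator and parameters, whereas
    \<open>g\<close> takes only index and parameters, so position 1 is skipped.\<close>
  have "recursive (Suc (Suc n)) (\<lambda>ys. (\<lambda>zs. g (zs ! 0) (tl zs))
      (map (\<lambda>h. h ys) ((\<lambda>ys. ys ! 0) # map (\<lambda>i ys. ys ! (i + 2)) [0..<n])))"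
    by (intro recursive.comp) (use g in \<open>auto intro: recursive_nth\<close>)
  then have "recursive (Suc (Suc n)) (\<lambda>ys. g (ys ! 0) (tl (tl ys)))"
  proof (rule recursive_cong)
    fix ys :: "nat list" assume "length ys = Suc (Suc n)"
    then have "tl (tl ys) = map (\<lambda>h. h ys) (map (\<lambda>i ys. ys ! (i + 2)) [0..<n])"
      by (intro nth_equalityI) (auto simp: nth_tl)
    then show "g (ys ! 0) (tl (tl ys)) = (\<lambda>zs. g (zs ! 0) (tl zs))
      (map (\<lambda>h. h ys) ((\<lambda>ys. ys ! 0) # map (\<lambda>i ys. ys ! (i + 2)) [0..<n]))" by simp
  qed
  then show "recursive n (\<lambda>xs. rec_nat 0 (\<lambda>y r. r + g y xs) (b xs))"
    by (intro recursive_rec_nat b recursive_add recursive_const recursive_nth) simp_all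
  have "(\<Sum>i<k. g i xs) = rec_nat 0 (\<lambda>y r. r + g y xs) k" for k xs
    by (induction k) auto
  then show "(\<Sum>i<b xs. g i xs) = rec_nat 0 (\<lambda>y r. r + g y xs) (b xs)" for xs .
qed

text \<open>With truncated subtraction, \<open>1 - (a - b)\<close> is the 0-1 indicator of
  \<open>a \<le> b\<close>.\<close>

lemma recursive_if_le:
  assumes "recursive n a" "recursive n b" "recursive n c" "recursive n d"
  shows "recursive n (\<lambda>xs. if a xs \<le> b xs then c xs else d xs)"
proof (rule recursive_cong)
  show "recursive n (\<lambda>xs. c xs * (1 - (a xs - b xs)) + d xs * (1 - (1 - (a xs - b xs))))"
    by (intro recursive_add recursive_mult recursive_diff recursive_const assms)
qed auto

lemma recursive_Least:
  assumes "recursive (Suc n) (\<lambda>ys. f (ys ! 0) (tl ys))"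
    and "\<And>xs. length xs = n \<Longrightarrow> \<exists>y. f y xs = 0"
  shows "recursive n (\<lambda>xs. LEAST y. f y xs = 0)"
  using recursive.minimize[of n "\<lambda>ys. f (ys ! 0) (tl ys)"] assms by simp

lemma recursive_div:
  assumes "recursive n a" "recursive n b"
  shows "recursive n (\<lambda>xs. a xs div b xs)"
proof (rule recursive_cong)
  \<comment> \<open>For a positive divisor this finds the least \<open>y\<close> with
    \<open>a < (y + 1) * b\<close>. The factor \<open>b xs\<close> makes the search stop at
    \<open>0\<close> when the divisor is zero, which matches \<open>a div 0 = 0\<close> and keeps
    the minimization total.\<close>
  show "recursive n (\<lambda>xs. LEAST y. b xs * (Suc (a xs) - Suc y * b xs) = 0)"
  proof (rule recursive_Least)
    show "recursive (Suc n)
        (\<lambda>ys. b (tl ys) * (Suc (a (tl ys)) - Suc (ys ! 0) * b (tl ys)))"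
      by (intro recursive_mult recursive_diff recursive_Suc recursive_tl recursive_nth assms) simp
    show "\<exists>y. b xs * (Suc (a xs) - Suc y * b xs) = 0" for xs
      by (rule exI[of _ "a xs"]) (cases "b xs"; simp)
  qed
  show "a xs div b xs = (LEAST y. b xs * (Suc (a xs) - Suc y * b xs) = 0)" for xs
  proof (rule Least_equality[symmetric])
    show "b xs * (Suc (a xs) - Suc (a xs div b xs) * b xs) = 0"
      using dividend_less_div_times[of "b xs" "a xs"] by (cases "b xs") auto
    fix y assume "b xs * (Suc (a xs) - Suc y * b xs) = 0"
    then show "a xs div b xs \<le> y"
      by (cases "b xs = 0") (auto simp: less_mult_imp_div_less less_Suc_eq_le[symmetric] simp del: mult_Suc)
  qed
qed

lemma recursive_prod_encode:
  assumes "recursive n a" "recursive n b"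
  shows "recursive n (\<lambda>xs. prod_encode (a xs, b xs))"
  unfolding prod_encode_def triangle_def prod.case
  by (intro recursive_add recursive_div recursive_mult recursive_Suc recursive_const assms)

lemma recursive_int_encode_diff:
  assumes "recursive n a" "recursive n b"
  shows "recursive n (\<lambda>xs. int_encode (int (a xs) - int (b xs)))"
proof (rule recursive_cong)
  show "recursive n (\<lambda>xs. if b xs \<le> a xs then 2 * (a xs - b xs) else Suc (2 * (b xs - a xs - 1)))"
    by (intro recursive_if_le recursive_mult recursive_diff recursive_Suc recursive_const assms)
qed (auto simp: int_encode_def sum_encode_def nat_diff_distrib)

lemma recursive_list_encode:
  "\<forall>g\<in>set gs. recursive n g \<Longrightarrow> recursive n (\<lambda>xs. list_encode (map (\<lambda>g. g xs) gs))"
  by (induction gs) (auto intro!: recursive_const recursive_Suc recursive_prod_encode)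

subsection \<open>Reals approximable with linear precision\<close>

text \<open>The fractions \<open>g [n] / n\<close> approximate \<open>x\<close> with error
  \<open>K / n\<close>. Leaving the constant \<open>K\<close> unspecified spares the bookkeeping of
  precision under arithmetic. Since \<open>g\<close> has natural values, only nonnegative reals
  qualify.\<close>

definition linearly_computable :: "real \<Rightarrow> bool" where
  "linearly_computable x \<longleftrightarrow>
    (\<exists>g K. recursive 1 g \<and> (\<forall>n. \<bar>real (g [n]) - real n * x\<bar> \<le> K))"

lemma linearly_computableI:
  assumes "recursive 1 (\<lambda>xs. g (xs ! 0))" "\<And>n. \<bar>real (g n) - real n * x\<bar> \<le> K"
  shows "linearly_computable x"
  unfolding linearly_computable_def
  using assms by (intro exI[of _ "\<lambda>xs. g (xs ! 0)"] exI[of _ K]) auto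

lemma linearly_computableE:
  assumes "linearly_computable x"
  obtains g K where "recursive 1 g" "\<And>n. \<bar>real (g [n]) - real n * x\<bar> \<le> K" "K > 0"
proof -
  obtain g K where "recursive 1 g" "\<And>n. \<bar>real (g [n]) - real n * x\<bar> \<le> K"
    using assms unfolding linearly_computable_def by blast
  then show ?thesis
    by (intro that[of g "max K 1"]) (auto intro: max.coboundedI1)
qed

lemma of_nat_div_bounds:
  fixes a b :: nat
  shows "real (a div b) \<le> real a / real b" "real a / real b \<le> real (a div b) + 1"
proof -
  have "real (a div b) = of_int \<lfloor>real a / real b\<rfloor>"
    by (simp add: floor_divide_of_nat_eq)
  then show "real (a div b) \<le> real a / real b" "real a / real b \<le> real (a div b) + 1"
    by linarith+
qed

lemma recursive_arg: "recursive 1 (\<lambda>xs. xs ! 0)"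
  by (rule recursive_nth) simp

text \<open>The denominator read from the code \<open>e\<close> is at most \<open>e\<close> in
  absolute value, and a nonzero numerator is at least 1. This converts a rational tolerance into a
  natural number precision.\<close>

lemma nat_to_rat_surj_inverse_le:
  assumes "nat_to_rat_surj e > 0"
  shows "1 / real (e + 1) < of_rat (nat_to_rat_surj e)"
proof -
  obtain a b where ab: "prod_decode e = (a, b)" by fastforce
  define i j where "i = int_decode a" and "j = int_decode b"
  have e: "e = prod_encode (a, b)"
    using ab by (metis prod_decode_inverse)
  have "\<bar>j\<bar> \<le> int b"
    by (auto simp: j_def int_decode_def sum_decode_def elim!: oddE split: if_splits)
  moreover have "b \<le> e"
    unfolding e by (rule le_prod_encode_2)
  ultimately have j: "\<bar>real_of_int j\<bar> \<le> real e" by linarith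
  have r: "nat_to_rat_surj e = Fract i j"
    by (simp add: nat_to_rat_surj_def ab i_def j_def)
  then have q: "(of_rat (nat_to_rat_surj e) :: real) = of_int i / of_int j"
    by (simp add: Fract_of_int_quotient of_rat_divide)
  have pos: "real_of_int i / of_int j > 0"
    using assms q by (metis zero_less_of_rat_iff)
  then have "j \<noteq> 0" "i \<noteq> 0" by auto
  then have ij: "\<bar>real_of_int i\<bar> \<ge> 1" "\<bar>real_of_int j\<bar> > 0" by linarith+
  have "1 / real (e + 1) < 1 / \<bar>real_of_int j\<bar>"
    using j ij by (intro divide_strict_left_mono) auto
  also have "\<dots> \<le> \<bar>real_of_int i\<bar> / \<bar>real_of_int j\<bar>"
    using ij by (intro divide_right_mono) auto
  also have "\<dots> = of_int i / of_int j"
    using pos by (metis abs_divide abs_of_pos)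
  finally show ?thesis using q by simp
qed

text \<open>Sampling \<open>g\<close> at \<open>m = k * Suc e\<close> with \<open>k > K\<close>
  brings the error of \<open>g [m] / m\<close> down to \<open>1 / (e + 1)\<close>, which is below
  the tolerance coded by \<open>e\<close>.\<close>

lemma linearly_computable_imp_computable_real:
  assumes "linearly_computable x"
  shows "computable_real x"
proof -
  obtain g K where g: "recursive 1 g" "\<And>n. \<bar>real (g [n]) - real n * x\<bar> \<le> K" "K > 0"
    using assms by (rule linearly_computableE) blast
  obtain k :: nat where k: "K < real k" using reals_Archimedean2 by blast
  with g(3) have k0: "k > 0" by (cases k) auto
  define f where "f = (\<lambda>xs. prod_encode
    (int_encode (int (g [k * Suc (xs ! 0)]) - int 0), int_encode (int (k * Suc (xs ! 0)) - int 0)))"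
  have "recursive 1 f"
    unfolding f_def
    by (intro recursive_prod_encode recursive_int_encode_diff recursive_comp1[OF g(1)]
        recursive_mult recursive_Suc recursive_const recursive_arg)
  moreover have "\<bar>of_rat (nat_to_rat_surj (f [e])) - x\<bar> < of_rat (nat_to_rat_surj e)"
    if e: "nat_to_rat_surj e > 0" for e
  proof -
    define m where "m = k * Suc e"
    have m: "real m > 0" "real m = real k * real (e + 1)" using k0 by (simp_all add: m_def algebra_simps add_pos_nonneg)
    have "\<bar>of_rat (nat_to_rat_surj (f [e])) - x\<bar> = \<bar>real (g [m]) / real m - x\<bar>"
      by (simp add: f_def nat_to_rat_surj_def Fract_of_int_quotient of_rat_divide of_rat_mult of_rat_add m_def del: mult_Suc_right)
    also have "\<dots> = \<bar>real (g [m]) - real m * x\<bar> / real m"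
      using m(1) by (simp add: abs_div_pos diff_divide_distrib)
    also have "\<dots> \<le> K / real m"
      using g(2) m(1) by (intro divide_right_mono) auto
    also have "\<dots> \<le> real k / real m"
      using k m(1) by (intro divide_right_mono) auto
    also have "\<dots> = 1 / real (e + 1)"
      using k0 unfolding m(2) by simp
    also have "\<dots> < of_rat (nat_to_rat_surj e)"
      using nat_to_rat_surj_inverse_le[OF e] .
    finally show ?thesis .
  qed
  ultimately show ?thesis unfolding computable_real_def by blast
qed

text \<open>\<open>n * g [n] / h [n]\<close> is close to \<open>n * (n x) / (n y) = n x / y\<close>.
  Once \<open>n y > 2 K\<close>, the denominator exceeds \<open>n y / 2\<close> and the error is at
  most \<open>B2\<close>. For the finitely many smaller \<open>n\<close> the denominator may even
  vanish, and the crude bound \<open>B1\<close> suffices. Truncation costs at most 1.\<close>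

lemma linearly_computable_divide:
  assumes "linearly_computable x" "linearly_computable y" "y > 0"
  shows "linearly_computable (x / y)"
proof -
  obtain g K1 where g: "recursive 1 g" "\<And>n. \<bar>real (g [n]) - real n * x\<bar> \<le> K1" "K1 > 0"
    using assms(1) by (rule linearly_computableE) blast
  obtain h K2 where h: "recursive 1 h" "\<And>n. \<bar>real (h [n]) - real n * y\<bar> \<le> K2" "K2 > 0"
    using assms(2) by (rule linearly_computableE) blast
  define K where "K = K1 + K2"
  have K: "\<bar>real (g [n]) - real n * x\<bar> \<le> K" "\<bar>real (h [n]) - real n * y\<bar> \<le> K" "K > 0" for n
    using g(2)[of n] h(2)[of n] g(3) h(3) by (auto simp: K_def)
  define M where "M = 2 * K / y"
  have M: "M > 0" using K(3) assms(3) by (simp add: M_def)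
  define B1 where "B1 = M * (M * \<bar>x\<bar> + K) + M * \<bar>x\<bar> / y"
  define B2 where "B2 = 2 * K * (y + \<bar>x\<bar>) / (y * y)"
  have B: "B1 \<ge> 0" "B2 \<ge> 0" using M K(3) assms(3) by (auto simp: B1_def B2_def)
  show ?thesis
  proof (rule linearly_computableI)
    show "recursive 1 (\<lambda>xs. xs ! 0 * g [xs ! 0] div h [xs ! 0])"
      by (intro recursive_div recursive_mult recursive_comp1[OF g(1)] recursive_comp1[OF h(1)]
          recursive_arg)
    fix n
    let ?q = "n * g [n] div h [n]"
    show "\<bar>real ?q - real n * (x / y)\<bar> \<le> B1 + B2 + 1"
    proof (cases "real n \<le> M")
      case True
      have "?q \<le> n * g [n]" by simp
      then have "real ?q \<le> real n * real (g [n])"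
        by (metis of_nat_le_iff of_nat_mult)
      also have "\<dots> \<le> M * (M * \<bar>x\<bar> + K)"
      proof (intro mult_mono True)
        have "real (g [n]) \<le> real n * x + K" using K(1)[of n] by linarith
        also have "real n * x \<le> real n * \<bar>x\<bar>"
          by (intro mult_left_mono) auto
        also have "\<dots> \<le> M * \<bar>x\<bar>"
          using True by (intro mult_right_mono) auto
        finally show "real (g [n]) \<le> M * \<bar>x\<bar> + K" by simp
      qed (use M in auto)
      finally have "real ?q \<le> M * (M * \<bar>x\<bar> + K)" .
      moreover have "\<bar>real n * (x / y)\<bar> \<le> M * \<bar>x\<bar> / y"
        using True assms(3) by (simp add: abs_mult divide_right_mono mult_right_mono)
      ultimately show ?thesis using B unfolding B1_def by linarith
    next
      case False
      then have n: "real n * y > 2 * K" using assms(3) by (simp add: M_def field_simps)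
      then have hn: "real (h [n]) > real n * y / 2" using K(2)[of n] by linarith
      have n0: "real n > 0" using False M by linarith
      have hpos: "real (h [n]) > 0" using hn n K(3) by linarith
      have "\<bar>real (g [n]) * y - real (h [n]) * x\<bar> =
        \<bar>(real (g [n]) - real n * x) * y - (real (h [n]) - real n * y) * x\<bar>"
        by (simp add: algebra_simps)
      also have "\<dots> \<le> \<bar>(real (g [n]) - real n * x) * y\<bar> + \<bar>(real (h [n]) - real n * y) * x\<bar>"
        by (rule abs_triangle_ineq4)
      also have "\<dots> \<le> K * y + K * \<bar>x\<bar>"
        unfolding abs_mult using assms(3) K by (intro add_mono mult_mono) auto
      finally have num: "\<bar>real (g [n]) * y - real (h [n]) * x\<bar> \<le> K * (y + \<bar>x\<bar>)"
        by (simp add: algebra_simps)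
      have "\<bar>real (n * g [n]) / real (h [n]) - real n * (x / y)\<bar> =
        \<bar>real (g [n]) * y - real (h [n]) * x\<bar> * (real n / (real (h [n]) * y))"
      proof -
        have "real (n * g [n]) / real (h [n]) - real n * (x / y) =
          (real (g [n]) * y - real (h [n]) * x) * (real n / (real (h [n]) * y))"
          using hpos assms(3) by (simp add: field_simps)
        then show ?thesis using hpos assms(3) by (simp add: abs_mult)
      qed
      also have "\<dots> \<le> (K * (y + \<bar>x\<bar>)) * (2 / (y * y))"
      proof (intro mult_mono num)
        show "real n / (real (h [n]) * y) \<le> 2 / (y * y)"
          using hn hpos assms(3) by (simp add: field_simps)
      qed (use K assms(3) hpos in auto)
      also have "\<dots> = B2" by (simp add: B2_def)
      finally have "\<bar>real (n * g [n]) / real (h [n]) - real n * (x / y)\<bar> \<le> B2" .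
      moreover have "\<bar>real ?q - real (n * g [n]) / real (h [n])\<bar> \<le> 1"
        using of_nat_div_bounds(1)[of "n * g [n]" "h [n]"] of_nat_div_bounds(2)[of "n * g [n]" "h [n]"]
        by linarith
      ultimately show ?thesis using B by linarith
    qed
  qed
qed

text \<open>At most one of two opposite truncated differences is nonzero, so their sum is the
  absolute difference. The offset \<open>b\<close> is split into its positive and negative parts
  \<open>p\<close> and \<open>q\<close> to stay within the naturals.\<close>

lemma linearly_computable_abs_affine:
  assumes "linearly_computable x"
  shows "linearly_computable \<bar>real a * x + of_int b\<bar>"
proof -
  obtain g K where g: "recursive 1 g" "\<And>n. \<bar>real (g [n]) - real n * x\<bar> \<le> K" "K > 0"
    using assms by (rule linearly_computableE) blast
  define p q where "p = nat b" and "q = nat (- b)"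
  have b: "real_of_int b = real p - real q" by (simp add: p_def q_def)
  show ?thesis
  proof (rule linearly_computableI)
    show "recursive 1 (\<lambda>xs. (a * g [xs ! 0] + p * xs ! 0 - q * xs ! 0)
        + (q * xs ! 0 - (a * g [xs ! 0] + p * xs ! 0)))"
      by (intro recursive_add recursive_diff recursive_mult recursive_comp1[OF g(1)]
          recursive_const recursive_arg)
    fix n
    let ?u = "a * g [n] + p * n" and ?v = "q * n"
    have "real ((?u - ?v) + (?v - ?u)) = \<bar>real a * real (g [n]) + real n * of_int b\<bar>"
      unfolding b by (cases "?u \<le> ?v") (auto simp: of_nat_diff algebra_simps simp flip: of_nat_mult of_nat_add)
    moreover have "real n * \<bar>real a * x + of_int b\<bar> = \<bar>real a * (real n * x) + real n * of_int b\<bar>"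
      by (simp add: abs_mult[symmetric, of "real n", simplified] algebra_simps)
    moreover have "\<bar>real a * real (g [n]) - real a * (real n * x)\<bar> \<le> real a * K"
      using g(2)[of n] by (simp add: abs_mult mult_left_mono flip: right_diff_distrib)
    ultimately show "\<bar>real ((?u - ?v) + (?v - ?u)) - real n * \<bar>real a * x + of_int b\<bar>\<bar> \<le> real a * K"
      by linarith
  qed
qed

lemma linearly_computable_half: "linearly_computable (1 / 2)"
proof (rule linearly_computableI)
  show "recursive 1 (\<lambda>xs. xs ! 0 div 2)"
    by (intro recursive_div recursive_const recursive_arg)
  show "\<bar>real (n div 2) - real n * (1 / 2)\<bar> \<le> 1" for n
    using of_nat_div_bounds(1)[of n 2] of_nat_div_bounds(2)[of n 2] by auto
qed

section \<open>Computing pi from a Riemann sum for the arctangent\<close>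

lemma arctan_diff_bounds:
  assumes "0 \<le> a" "a < b"
  shows "(b - a) / (1 + b\<^sup>2) \<le> arctan b - arctan a" "arctan b - arctan a \<le> (b - a) / (1 + a\<^sup>2)"
proof -
  \<comment> \<open>The derivative decreases on the nonnegative reals, so its value at the
    intermediate point lies between those at \<open>b\<close> and \<open>a\<close>.\<close>
  obtain z where z: "a < z" "z < b" "arctan b - arctan a = (b - a) * inverse (1 + z\<^sup>2)"
    using MVT2[OF assms(2), of arctan "\<lambda>x. inverse (1 + x\<^sup>2)"] DERIV_arctan by auto
  have "a\<^sup>2 \<le> z\<^sup>2" "z\<^sup>2 \<le> b\<^sup>2" using z assms by (auto intro!: power_mono)
  moreover have "1 + a\<^sup>2 > 0" by (simp add: add_pos_nonneg)
  moreover have "1 + z\<^sup>2 > 0" by (simp add: add_pos_nonneg)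
  ultimately have "inverse (1 + b\<^sup>2) \<le> inverse (1 + z\<^sup>2)" "inverse (1 + z\<^sup>2) \<le> inverse (1 + a\<^sup>2)"
    by (intro le_imp_inverse_le; simp)+
  then show "(b - a) / (1 + b\<^sup>2) \<le> arctan b - arctan a" "arctan b - arctan a \<le> (b - a) / (1 + a\<^sup>2)"
    unfolding z(3) divide_inverse using assms by (auto intro!: mult_left_mono)
qed

text \<open>The sum of the \<open>f k\<close> is the left Riemann sum of
  \<open>1 / (1 + t^2)\<close> on the unit interval with mesh \<open>1 / n\<close>. It exceeds the
  right sum by \<open>f 0 - f n\<close>, and \<open>arctan 1 = pi / 4\<close> lies between the
  two.\<close>

lemma arctan_riemann_sum:
  assumes "n > 0"
  defines "f \<equiv> \<lambda>k. real n / ((real n)\<^sup>2 + (real k)\<^sup>2)"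
  shows "pi / 4 \<le> (\<Sum>k<n. f k)" "(\<Sum>k<n. f k) \<le> pi / 4 + 1 / n"
proof -
  have f: "f k = (1 / real n) / (1 + (real k / real n)\<^sup>2)" for k
  proof -
    have "1 + (real k / real n)\<^sup>2 = ((real n)\<^sup>2 + (real k)\<^sup>2) / (real n)\<^sup>2"
      using assms(1) by (simp add: field_simps)
    then show ?thesis using assms(1) by (simp add: f_def power2_eq_square)
  qed
  define \<phi> where "\<phi> = (\<lambda>k. arctan (real k / real n))"
  have step: "f (Suc k) \<le> \<phi> (Suc k) - \<phi> k" "\<phi> (Suc k) - \<phi> k \<le> f k" for k
    using arctan_diff_bounds[of "real k / real n" "real (Suc k) / real n"] assms(1)
    unfolding f \<phi>_def by (simp_all add: divide_strict_right_mono flip: diff_divide_distrib)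
  have tele: "(\<Sum>k<n. \<phi> (Suc k) - \<phi> k) = pi / 4"
    using assms(1) by (subst sum_lessThan_telescope) (simp add: \<phi>_def arctan_one)
  show "pi / 4 \<le> (\<Sum>k<n. f k)"
    unfolding tele[symmetric] by (intro sum_mono step)
  have "(\<Sum>k<n. f k) = (\<Sum>k<n. f (Suc k)) - (\<Sum>k<n. f (Suc k) - f k)"
    by (simp add: sum_subtractf)
  also have "(\<Sum>k<n. f (Suc k) - f k) = f n - f 0"
    by (rule sum_lessThan_telescope)
  also have "(\<Sum>k<n. f (Suc k)) \<le> pi / 4"
    unfolding tele[symmetric] by (intro sum_mono step)
  also have "f 0 = 1 / n" using assms(1) by (simp add: f_def power2_eq_square)
  finally have "(\<Sum>k<n. f k) \<le> pi / 4 - (f n - 1 / n)" by simp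
  moreover have "f n \<ge> 0" by (simp add: f_def)
  ultimately show "(\<Sum>k<n. f k) \<le> pi / 4 + 1 / n" by linarith
qed

text \<open>After scaling by \<open>4 n^2\<close> the Riemann error is at most \<open>4 n\<close>,
  and rounding down each of the \<open>n\<close> summands loses at most \<open>n\<close>. The final
  division by \<open>n\<close> leaves a bounded error.\<close>

lemma linearly_computable_pi: "linearly_computable pi"
proof (rule linearly_computableI)
  show "recursive 1 (\<lambda>xs. (\<Sum>k<xs ! 0. 4 * (xs ! 0 * xs ! 0 * xs ! 0) div (xs ! 0 * xs ! 0 + k * k)) div xs ! 0)"
    by (intro recursive_div recursive_sum recursive_mult recursive_add recursive_const
        recursive_arg recursive_tl recursive_nth) simp_all
  fix n
  let ?t = "\<lambda>k::nat. 4 * (n * n * n) div (n * n + k * k)"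
  let ?S = "\<Sum>k<n. ?t k"
  show "\<bar>real (?S div n) - real n * pi\<bar> \<le> 5"
  proof (cases "n = 0")
    case False
    define f where "f = (\<lambda>k. real n / ((real n)\<^sup>2 + (real k)\<^sup>2))"
    have t: "4 * (real n)\<^sup>2 * f k - 1 \<le> real (?t k)" "real (?t k) \<le> 4 * (real n)\<^sup>2 * f k" for k
    proof -
      have "real (4 * (n * n * n)) / real (n * n + k * k) = 4 * (real n)\<^sup>2 * f k"
        by (simp add: f_def power2_eq_square)
      then show "4 * (real n)\<^sup>2 * f k - 1 \<le> real (?t k)" "real (?t k) \<le> 4 * (real n)\<^sup>2 * f k"
        using of_nat_div_bounds(1)[of "4 * (n * n * n)" "n * n + k * k"]
          of_nat_div_bounds(2)[of "4 * (n * n * n)" "n * n + k * k"] by linarith+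
    qed
    note riemann = arctan_riemann_sum[of n, folded f_def]
    have n2: "4 * (real n)\<^sup>2 > 0" using False by simp
    have "4 * (real n)\<^sup>2 * (pi / 4) - n \<le> 4 * (real n)\<^sup>2 * (\<Sum>k<n. f k) - n"
      using riemann(1) False n2 by simp
    also have "\<dots> = (\<Sum>k<n. 4 * (real n)\<^sup>2 * f k - 1)"
      by (simp add: sum_subtractf sum_distrib_left)
    also have "\<dots> \<le> (\<Sum>k<n. real (?t k))" by (intro sum_mono t)
    finally have lo: "4 * (real n)\<^sup>2 * (pi / 4) - n \<le> real ?S" by simp
    have "real ?S = (\<Sum>k<n. real (?t k))" by simp
    also have "\<dots> \<le> (\<Sum>k<n. 4 * (real n)\<^sup>2 * f k)" by (intro sum_mono t)
    also have "\<dots> = 4 * (real n)\<^sup>2 * (\<Sum>k<n. f k)" by (simp add: sum_distrib_left)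
    also have "\<dots> \<le> 4 * (real n)\<^sup>2 * (pi / 4 + 1 / n)"
      using riemann(2) False n2 by (intro mult_left_mono) auto
    finally have hi: "real ?S \<le> 4 * (real n)\<^sup>2 * (pi / 4 + 1 / n)" .
    have "4 * (real n)\<^sup>2 * (pi / 4) - n = (real n * pi - 1) * real n"
      by (simp add: algebra_simps power2_eq_square)
    then have "real n * pi - 1 \<le> real ?S / real n"
      using lo False by (simp only: pos_le_divide_eq of_nat_0_less_iff neq0_conv)
    moreover have "4 * (real n)\<^sup>2 * (pi / 4 + 1 / n) = (real n * pi + 4) * real n"
      using False by (simp add: field_simps power2_eq_square)
    then have "real ?S / real n \<le> real n * pi + 4"
      using hi False by (simp only: pos_divide_le_eq of_nat_0_less_iff neq0_conv)
    ultimately show ?thesis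
      using of_nat_div_bounds(1)[of ?S n] of_nat_div_bounds(2)[of ?S n] by linarith
  qed simp
qed

subsection \<open>Positivity queries depending on parameters\<close>

definition satisfies_recurrence :: "rat list \<Rightarrow> (nat \<Rightarrow> rat) \<Rightarrow> bool" where
  "satisfies_recurrence cs u \<longleftrightarrow>
    (\<forall>n. u (n + length cs) = (\<Sum>i<length cs. cs ! i * u (n + length cs - Suc i)))"

lemma lrs_eq:
  assumes "satisfies_recurrence cs u"
  shows "lrs cs (map u [0..<length cs]) n = u n"
proof (induction n rule: less_induct)
  case (less n)
  show ?case
  proof (cases "n < length cs")
    case True
    then show ?thesis by (simp add: lrs_initial)
  next
    case False
    then obtain m where n: "n = m + length cs" by (metis add.commute le_Suc_ex not_less)
    have "lrs cs (map u [0..<length cs]) n = (\<Sum>i<length cs. cs ! i * u (m + length cs - Suc i))"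
      unfolding n lrs_recurrence by (intro sum.cong refl) (auto simp: n intro!: less)
    then show ?thesis
      using assms unfolding satisfies_recurrence_def n by simp
  qed
qed

lemma satisfies_recurrence_combination:
  assumes "satisfies_recurrence cs u" "satisfies_recurrence cs v"
  shows "satisfies_recurrence cs (\<lambda>n. a * u n + b * v n)"
  using assms unfolding satisfies_recurrence_def
  by (simp add: distrib_left sum.distrib sum_distrib_left mult.left_commute)

text \<open>Over the common denominator \<open>b * d\<close> the numerator is
  \<open>p * A + q * B\<close>; the signed constants \<open>A\<close> and \<open>B\<close> are split
  into positive and negative parts.\<close>

lemma recursive_affine_rat:
  "\<exists>g. recursive 2 g \<and> (\<forall>p q. nat_to_rat_surj (g [p, q]) = of_nat p * \<alpha> + of_nat q * \<beta>)"
proof -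
  obtain a b where \<alpha>: "\<alpha> = Fract a b" "b > 0" by (cases \<alpha>) auto
  obtain c d where \<beta>: "\<beta> = Fract c d" "d > 0" by (cases \<beta>) auto
  define A B where "A = a * d" and "B = c * b"
  define f where "f = (\<lambda>xs::nat list. prod_encode
    (int_encode (int (xs ! 0 * nat A + xs ! 1 * nat B) - int (xs ! 0 * nat (- A) + xs ! 1 * nat (- B))),
     int_encode (b * d)))"
  have "recursive 2 f"
    unfolding f_def
    by (intro recursive_prod_encode recursive_int_encode_diff recursive_add recursive_mult
        recursive_const recursive_nth) simp_all
  moreover have "nat_to_rat_surj (f [p, q]) = of_nat p * \<alpha> + of_nat q * \<beta>" for p q
  proof -
    have *: "int (nat i) - int (nat (- i)) = i" for i by simp
    have "int (p * nat A + q * nat B) - int (p * nat (- A) + q * nat (- B)) =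
      int p * (int (nat A) - int (nat (- A))) + int q * (int (nat B) - int (nat (- B)))"
      unfolding of_nat_mult of_nat_add by (simp only: algebra_simps)
    also have "\<dots> = int p * A + int q * B"
      unfolding * ..
    finally have "nat_to_rat_surj (f [p, q]) = Fract (int p * A + int q * B) (b * d)"
      by (simp add: f_def nat_to_rat_surj_def)
    also have "\<dots> = of_nat p * \<alpha> + of_nat q * \<beta>"
      using \<alpha>(2) \<beta>(2) unfolding \<alpha>(1) \<beta>(1) A_def B_def Fract_of_int_quotient
      by (simp add: field_simps)
    finally show ?thesis .
  qed
  ultimately show ?thesis by blast
qed

text \<open>The decoder \<open>d\<close> is kept abstract because the lemma is used at two levels:
  for the initial terms of one sequence, and for the list of all sequences.\<close>

lemma recursive_list_code:
  assumes "\<forall>y\<in>set ys. \<exists>g. recursive 2 g \<and> (\<forall>p q. d (g [p, q]) = h p q y)"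
  shows "\<exists>g. recursive 2 g \<and> (\<forall>p q. map d (list_decode (g [p, q])) = map (h p q) ys)"
proof -
  obtain g where g: "\<And>y. y \<in> set ys \<Longrightarrow> recursive 2 (g y)"
      "\<And>y p q. y \<in> set ys \<Longrightarrow> d (g y [p, q]) = h p q y"
    using assms by metis
  have "recursive 2 (\<lambda>xs. list_encode (map (\<lambda>g. g xs) (map g ys)))"
    using g by (intro recursive_list_encode) auto
  then show ?thesis
    using g(2) by (intro exI[of _ "\<lambda>xs. list_encode (map (\<lambda>g. g xs) (map g ys))"]) auto
qed

text \<open>All combinations of \<open>u\<close> and \<open>v\<close> obey the same recurrence, and
  their initial terms are affine in \<open>p\<close> and \<open>q\<close>. Hence a code of the
  instance is computable from \<open>p\<close> and \<open>q\<close> and can be fed to the decision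
  procedure.\<close>

lemma recursive_positivity_query:
  assumes "simultaneous_positivity_decidable" "cs \<noteq> []" "uvs \<noteq> []"
    and rec: "\<forall>(u, v)\<in>set uvs. satisfies_recurrence cs u \<and> satisfies_recurrence cs v"
  shows "\<exists>D. recursive 2 D \<and> (\<forall>p q. D [p, q] =
    (if \<exists>n. \<forall>(u, v)\<in>set uvs. of_nat p * u n + of_nat q * v n \<ge> 0 then 1 else 0))"
proof -
  obtain h where h: "recursive 1 h"
      "\<And>c. spp_wf (spp_decode c) \<Longrightarrow> h [c] = (if spp_yes (spp_decode c) then 1 else 0)"
    using assms(1) unfolding simultaneous_positivity_decidable_def by blast
  define comb where "comb = (\<lambda>p q (uv :: (nat \<Rightarrow> rat) \<times> (nat \<Rightarrow> rat)) n.
    of_nat p * fst uv n + of_nat q * snd uv n)"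
  define init where "init = (\<lambda>p q uv. map (comb p q uv) [0..<length cs])"
  have "\<exists>g. recursive 2 g \<and> (\<forall>p q. decode_rats (g [p, q]) = init p q uv)" for uv
    unfolding decode_rats_def init_def comb_def
    by (rule recursive_list_code) (blast intro: recursive_affine_rat)
  then obtain g where g: "recursive 2 g"
      "\<And>p q. map decode_rats (list_decode (g [p, q])) = map (init p q) uvs"
    using recursive_list_code[of uvs decode_rats init] by blast
  \<comment> \<open>Surjectivity supplies some code of the fixed coefficient list; it enters the
    algorithm as a constant.\<close>
  obtain c where c: "fst (spp_decode c) = cs"
    using surj_spp_decode by (metis fst_conv surj_def)
  define a where "a = fst (prod_decode c)"
  have a: "decode_rats a = cs"
    using c by (simp add: spp_decode_def a_def split: prod.splits)
  define D where "D = (\<lambda>xs. h [prod_encode (a, g xs)])"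
  have dec: "spp_decode (prod_encode (a, g [p, q])) = (cs, map (init p q) uvs)" for p q
    by (simp add: spp_decode_def a g(2))
  have yes: "spp_yes (cs, map (init p q) uvs) \<longleftrightarrow>
    (\<exists>n. \<forall>(u, v)\<in>set uvs. of_nat p * u n + of_nat q * v n \<ge> 0)" for p q
  proof -
    have "lrs cs (init p q uv) n = comb p q uv n" if "uv \<in> set uvs" for uv n
    proof -
      have "satisfies_recurrence cs (comb p q uv)"
        using that rec unfolding comb_def by (intro satisfies_recurrence_combination) auto
      then show ?thesis unfolding init_def by (rule lrs_eq)
    qed
    then show ?thesis by (simp add: spp_yes_def comb_def case_prod_beta)
  qed
  have "recursive 2 D"
    unfolding D_def
    by (intro recursive_comp1[OF h(1)] recursive_prod_encode recursive_const g(1))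
  moreover have "D [p, q] =
    (if \<exists>n. \<forall>(u, v)\<in>set uvs. of_nat p * u n + of_nat q * v n \<ge> 0 then 1 else 0)" for p q
  proof -
    have "spp_wf (spp_decode (prod_encode (a, g [p, q])))"
      using assms(2,3) by (auto simp: dec spp_wf_def init_def)
    from h(2)[OF this] show ?thesis
      unfolding D_def dec yes .
  qed
  ultimately show ?thesis by blast
qed

section \<open>Powers of a rational point of the unit circle and their recurrences\<close>

fun rot :: "rat \<Rightarrow> rat \<Rightarrow> nat \<Rightarrow> rat \<times> rat" where
  "rot a b 0 = (1, 0)"
| "rot a b (Suc n) = (case rot a b n of (c, s) \<Rightarrow> (a * c - b * s, a * s + b * c))"

lemma rot_power:
  "(of_rat a + \<i> * of_rat b) ^ n = of_rat (fst (rot a b n)) + \<i> * of_rat (snd (rot a b n))"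
proof (induction n)
  case (Suc n)
  then show ?case
    by (cases "rot a b n") (simp add: of_rat_add of_rat_diff of_rat_mult algebra_simps)
qed simp

text \<open>A point of the unit circle and its conjugate have sum \<open>2 a\<close> and product
  \<open>1\<close>, so their powers follow the characteristic polynomial
  \<open>t^2 - 2 a t + 1\<close>.\<close>

lemma rot_recurrence:
  assumes "a\<^sup>2 + b\<^sup>2 = 1"
  shows "fst (rot a b (Suc (Suc n))) = 2 * a * fst (rot a b (Suc n)) - fst (rot a b n)"
    and "snd (rot a b (Suc (Suc n))) = 2 * a * snd (rot a b (Suc n)) - snd (rot a b n)"
proof -
  obtain c s where r: "rot a b n = (c, s)" by fastforce
  have b: "b * b = 1 - a * a" using assms by (simp add: power2_eq_square)
  have *: "b * (b * x) = (1 - a * a) * x" for x by (simp only: b flip: mult.assoc)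
  show "fst (rot a b (Suc (Suc n))) = 2 * a * fst (rot a b (Suc n)) - fst (rot a b n)"
    "snd (rot a b (Suc (Suc n))) = 2 * a * snd (rot a b (Suc n)) - snd (rot a b n)"
    by (simp_all add: r algebra_simps *)
qed

lemma sum_lessThan_4: "(\<Sum>i<4::nat. f i) = f 0 + f 1 + f 2 + (f 3 :: rat)"
  by (simp add: numeral_eq_Suc)

text \<open>Coefficients from the characteristic polynomial \<open>(t\<^sup>2 - 2 a t + 1)\<^sup>2\<close>.\<close>

lemma satisfies_recurrence_double:
  assumes u: "\<And>n. u (Suc (Suc n)) = 2 * a * u (Suc n) - u n"
  defines "cs \<equiv> [4 * a, - (4 * a * a + 2), 4 * a, - 1]"
  shows "satisfies_recurrence cs (\<lambda>n. u (Suc n))"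
    and "satisfies_recurrence cs (\<lambda>n. of_nat (Suc n) * u (Suc n))"
proof -
  have l: "length cs = 4" by (simp add: cs_def)
  have n: "n + 4 - Suc 0 = n + 3" "n + 4 - Suc 1 = n + 2" "n + 4 - Suc 2 = n + 1" "n + 4 - Suc 3 = n" for n :: nat
    by auto
  \<comment> \<open>These equations eliminate the three latest terms, leaving a polynomial identity
    in the two values called \<open>x\<close> and \<open>y\<close> below.\<close>
  have e: "u (Suc (n + 4)) = 2 * a * u (Suc (n + 3)) - u (Suc (n + 2))"
    "u (Suc (n + 3)) = 2 * a * u (Suc (n + 2)) - u (Suc (n + 1))"
    "u (Suc (n + 2)) = 2 * a * u (Suc (n + 1)) - u (Suc n)" for n
    using u[of "n + 3"] u[of "n + 2"] u[of "n + 1"] by (simp_all add: numeral_eq_Suc)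
  have c: "cs ! 0 = 4 * a" "cs ! 1 = - (4 * a * a + 2)" "cs ! 2 = 4 * a" "cs ! 3 = - 1"
    by (simp_all add: cs_def)
  show "satisfies_recurrence cs (\<lambda>n. u (Suc n))"
    unfolding satisfies_recurrence_def l sum_lessThan_4 n c
  proof
    fix n
    define x y where "x = u (Suc n)" and "y = u (Suc (n + 1))"
    show "u (Suc (n + 4)) = 4 * a * u (Suc (n + 3)) + - (4 * a * a + 2) * u (Suc (n + 2)) +
        4 * a * u (Suc (n + 1)) + - 1 * u (Suc n)"
      unfolding e x_def[symmetric] y_def[symmetric] by (simp add: algebra_simps)
  qed
  show "satisfies_recurrence cs (\<lambda>n. of_nat (Suc n) * u (Suc n))"
    unfolding satisfies_recurrence_def l sum_lessThan_4 n c
  proof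
    fix n
    define x y where "x = u (Suc n)" and "y = u (Suc (n + 1))"
    show "of_nat (Suc (n + 4)) * u (Suc (n + 4)) = 4 * a * (of_nat (Suc (n + 3)) * u (Suc (n + 3))) +
        - (4 * a * a + 2) * (of_nat (Suc (n + 2)) * u (Suc (n + 2))) +
        4 * a * (of_nat (Suc (n + 1)) * u (Suc (n + 1))) + - 1 * (of_nat (Suc n) * u (Suc n))"
      unfolding e x_def[symmetric] y_def[symmetric] by (simp add: algebra_simps)
  qed
qed

text \<open>Coefficients from the characteristic polynomial \<open>(t - 1)\<^sup>2 (t\<^sup>2 - 2 a t + 1)\<close>.\<close>

lemma satisfies_recurrence_linear:
  assumes u: "\<And>n. u (Suc (Suc n)) = 2 * a * u (Suc n) - u n"
  defines "cs \<equiv> [2 * a + 2, - (4 * a + 2), 2 * a + 2, - 1]"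
  shows "satisfies_recurrence cs u"
    and "satisfies_recurrence cs (\<lambda>n. \<alpha> * of_nat n + \<beta>)"
proof -
  have l: "length cs = 4" by (simp add: cs_def)
  have n: "n + 4 - Suc 0 = n + 3" "n + 4 - Suc 1 = n + 2" "n + 4 - Suc 2 = n + 1" "n + 4 - Suc 3 = n" for n :: nat
    by auto
  have e: "u (n + 4) = 2 * a * u (n + 3) - u (n + 2)"
    "u (n + 3) = 2 * a * u (n + 2) - u (n + 1)"
    "u (n + 2) = 2 * a * u (n + 1) - u n" for n
    using u[of "n + 2"] u[of "n + 1"] u[of n] by (simp_all add: numeral_eq_Suc)
  have c: "cs ! 0 = 2 * a + 2" "cs ! 1 = - (4 * a + 2)" "cs ! 2 = 2 * a + 2" "cs ! 3 = - 1"
    by (simp_all add: cs_def)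
  show "satisfies_recurrence cs u"
    unfolding satisfies_recurrence_def l sum_lessThan_4 n c
  proof
    fix n
    define x y where "x = u n" and "y = u (n + 1)"
    show "u (n + 4) = (2 * a + 2) * u (n + 3) + - (4 * a + 2) * u (n + 2) +
        (2 * a + 2) * u (n + 1) + - 1 * u n"
      unfolding e x_def[symmetric] y_def[symmetric] by (simp add: algebra_simps)
  qed
  show "satisfies_recurrence cs (\<lambda>n. \<alpha> * of_nat n + \<beta>)"
    unfolding satisfies_recurrence_def l sum_lessThan_4 n c by (simp add: algebra_simps)
qed

subsection \<open>The Diophantine approximation type\<close>

text \<open>Negating the numerator turns an approximation of \<open>x\<close> into an equally good
  one of \<open>- x\<close>. This allows \<open>Arg z\<close> to be replaced by its absolute
  value.\<close>

lemma dioph_type_minus: "dioph_type (- x) = dioph_type x"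
proof -
  define P where "P = (\<lambda>y c :: real. \<exists>n m :: int. m \<noteq> 0 \<and> \<bar>y - of_int n / of_int m\<bar> < c / (of_int m)\<^sup>2)"
  have imp: "P (- y) c" if yc: "P y c" for y c :: real
  proof -
    obtain n m :: int where m: "m \<noteq> 0" "\<bar>y - of_int n / of_int m\<bar> < c / (of_int m)\<^sup>2"
      using yc unfolding P_def by (elim exE conjE)
    have "\<bar>- y - of_int (- n) / of_int m\<bar> = \<bar>y - of_int n / of_int m\<bar>"
      by (simp add: abs_minus_commute)
    then have "\<bar>- y - of_int (- n) / of_int m\<bar> < c / (of_int m)\<^sup>2" using m(2) by (simp only:)
    with m(1) show ?thesis unfolding P_def by (intro exI conjI)
  qed
  have "P (- x) c \<longleftrightarrow> P x c" for c
    using imp[of x c] imp[of "- x" c] unfolding minus_minus by blast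
  then show ?thesis by (simp only: dioph_type_def P_def)
qed

lemma dioph_type_set_iff:
  fixes m n :: int and x c :: real
  assumes "m \<noteq> 0"
  shows "\<bar>x - of_int n / of_int m\<bar> < c / (of_int m)\<^sup>2 \<longleftrightarrow>
    \<bar>of_int m\<bar> * \<bar>of_int m * x - of_int n\<bar> < c"
proof -
  have "\<bar>of_int m\<bar> * \<bar>of_int m * x - of_int n\<bar> = \<bar>x - of_int n / of_int m\<bar> * (of_int m)\<^sup>2"
  proof -
    have "of_int m * x - of_int n = of_int m * (x - of_int n / of_int m)"
      using assms by (simp add: field_simps)
    then show ?thesis by (simp add: abs_mult power2_eq_square)
  qed
  then show ?thesis using assms by (simp add: pos_less_divide_eq)
qed

lemma dioph_type_le:
  fixes m :: nat and k :: int
  assumes "m \<ge> 1"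
  shows "dioph_type x \<le> real m * \<bar>real m * x - of_int k\<bar>"
\<comment> \<open>The defining inequality is strict: the value itself need not belong to the set,
  but every larger number does.\<close>
proof (rule field_le_epsilon)
  fix e :: real assume "e > 0"
  then have "\<bar>x - of_int k / of_int (int m)\<bar> <
      (real m * \<bar>real m * x - of_int k\<bar> + e) / (of_int (int m))\<^sup>2"
    using assms by (subst dioph_type_set_iff) auto
  then have "real m * \<bar>real m * x - of_int k\<bar> + e \<in> {c. \<exists>n m :: int. m \<noteq> 0 \<and>
      \<bar>x - of_int n / of_int m\<bar> < c / (of_int m)\<^sup>2}"
    using assms by (intro CollectI exI[of _ k] exI[of _ "int m"]) auto
  then show "dioph_type x \<le> real m * \<bar>real m * x - of_int k\<bar> + e"
    unfolding dioph_type_def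
  proof (rule cInf_lower)
    show "bdd_below {c. \<exists>n m :: int. m \<noteq> 0 \<and> \<bar>x - of_int n / of_int m\<bar> < c / (of_int m)\<^sup>2}"
    proof (rule bdd_belowI[of _ 0])
      fix c assume "c \<in> {c. \<exists>n m :: int. m \<noteq> 0 \<and> \<bar>x - of_int n / of_int m\<bar> < c / (of_int m)\<^sup>2}"
      then obtain n m :: int where "\<bar>of_int m\<bar> * \<bar>of_int m * x - of_int n\<bar> < c"
        using dioph_type_set_iff by blast
      then show "0 \<le> c" by (smt (verit) abs_ge_zero mult_nonneg_nonneg)
    qed
  qed
qed

lemma dioph_type_lessD:
  assumes "dioph_type x < c"
  shows "\<exists>m \<ge> 1. \<exists>k :: int. real m * \<bar>real m * x - of_int k\<bar> < c"
proof -
  have ne: "{c. \<exists>n m :: int. m \<noteq> 0 \<and> \<bar>x - of_int n / of_int m\<bar> < c / (of_int m)\<^sup>2} \<noteq> {}"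
    by (intro ex_in_conv[THEN iffD1] exI[of _ "\<bar>x\<bar> + 1"] CollectI exI[of _ 0] exI[of _ 1]) simp
  obtain d n m where "d < c" "m \<noteq> 0" and *: "\<bar>x - of_int n / of_int m\<bar> < d / (of_int m)\<^sup>2"
    using cInf_lessD[OF ne assms[unfolded dioph_type_def]] by blast
  then have lt: "\<bar>of_int m\<bar> * \<bar>of_int m * x - of_int n\<bar> < c"
    using dioph_type_set_iff by fastforce
  have m: "real (nat \<bar>m\<bar>) = \<bar>of_int m\<bar>" by simp
  \<comment> \<open>The sign of the denominator is moved into the numerator.\<close>
  have "\<bar>\<bar>of_int m\<bar> * x - of_int (sgn m * n)\<bar> = \<bar>of_int m * x - of_int n\<bar>"
    using \<open>m \<noteq> 0\<close> by (cases "m > 0") auto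
  then have "real (nat \<bar>m\<bar>) * \<bar>real (nat \<bar>m\<bar>) * x - of_int (sgn m * n)\<bar> < c"
    using lt unfolding m by simp
  moreover have "nat \<bar>m\<bar> \<ge> 1" using \<open>m \<noteq> 0\<close> by simp
  ultimately show ?thesis by blast
qed

lemma dioph_type_nonneg: "dioph_type x \<ge> 0"
proof (rule ccontr)
  assume "\<not> dioph_type x \<ge> 0"
  then obtain m k where "real m * \<bar>real m * x - of_int k\<bar> < 0"
    using dioph_type_lessD[of x 0] by auto
  then show False by (smt (verit) mult_nonneg_nonneg of_nat_0_le_iff)
qed

text \<open>Each of the finitely many \<open>m \<le> M\<close> has its best value, taken at the
  nearest integer, strictly above the infimum. Lowering \<open>c\<close> to the least of these
  values forces \<open>m > M\<close>.\<close>

lemma dioph_type_not_attained_large: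
  assumes not_att: "\<And>m k. m \<ge> 1 \<Longrightarrow> dioph_type x \<noteq> real m * \<bar>real m * x - of_int k\<bar>"
    and "dioph_type x < c"
  shows "\<exists>m > M. \<exists>k :: int. real m * \<bar>real m * x - of_int k\<bar> < c"
proof -
  define f where "f = (\<lambda>m. real m * \<bar>real m * x - of_int (round (real m * x))\<bar>)"
  define c' where "c' = Min (insert c (f ` {1..M}))"
  have "dioph_type x < f m" if "m \<ge> 1" for m
    using dioph_type_le[OF that, of x] not_att[OF that] unfolding f_def by (simp add: less_le)
  then have "dioph_type x < c'"
    using assms(2) by (auto simp: c'_def)
  then obtain m k where m: "m \<ge> 1" "real m * \<bar>real m * x - of_int k\<bar> < c'"
    using dioph_type_lessD by blast
  have "f m \<le> real m * \<bar>real m * x - of_int k\<bar>"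
    unfolding f_def by (intro mult_left_mono round_diff_minimal) auto
  with m have "f m < c'" by simp
  then have "m > M" using m(1) unfolding c'_def by (auto simp: not_less[symmetric])
  moreover have "real m * \<bar>real m * x - of_int k\<bar> < c"
    using m(2) by (simp add: c'_def)
  ultimately show ?thesis by blast
qed

section \<open>Comparing sine and cosine with the distance to the nearest integer\<close>

lemma le_tan:
  assumes "0 \<le> x" "x < pi / 2"
  shows "x \<le> tan x"
proof (cases "x = 0")
  case False
  then have "tan x > 0" using assms tan_gt_zero by simp
  \<comment> \<open>This is \<open>arctan t \<le> t\<close> at \<open>t = tan x\<close>, which needs
    \<open>t > 0\<close>.\<close>
  then show ?thesis
    using arctan_diff_bounds(2)[of 0 "tan x"] arctan_tan[of x] assms by simp
qed simp

text \<open>The half-angle formula gives \<open>1 - cos x = 2 * (sin (x / 2))^2\<close>, and sine is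
  bounded by its argument.\<close>

lemma cos_ge_one_minus: "1 - x\<^sup>2 / 2 \<le> cos (x :: real)"
proof -
  have "(sin (x / 2))\<^sup>2 \<le> (x / 2)\<^sup>2"
    using abs_sin_x_le_abs_x[of "x / 2"] by (simp only: abs_le_square_iff)
  then show ?thesis
    using cos_double_sin[of "x / 2"] by (simp add: power_divide)
qed

text \<open>The angle \<open>\<phi>\<close> is \<open>m * \<theta>\<close> with \<open>k\<close>
  full turns removed, so it is small exactly when \<open>m * x\<close> is close to
  \<open>k\<close>.\<close>

lemma sin_cos_shift:
  fixes \<theta> :: real and m :: nat and k :: int
  defines "\<phi> \<equiv> 2 * pi * (real m * (\<theta> / (2 * pi)) - of_int k)"
  shows "sin (real m * \<theta>) = sin \<phi>" "cos (real m * \<theta>) = cos \<phi>"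
proof -
  have "real m * \<theta> = \<phi> + 2 * pi * of_int k" by (simp add: \<phi>_def algebra_simps)
  then show "sin (real m * \<theta>) = sin \<phi>" "cos (real m * \<theta>) = cos \<phi>"
    by (simp_all add: sin_add cos_add sin_int_2pin cos_int_2pin)
qed

text \<open>
  The tangent dominates the angle, so a solution never understates the distance to the nearest
  integer; this makes the equivalence exact, with no error term for small \<open>m\<close>.
\<close>

lemma dioph_type_less_iff_sin_cos:
  fixes \<theta> C :: real
  defines "x \<equiv> \<theta> / (2 * pi)"
  assumes not_att: "\<And>m k. m \<ge> 1 \<Longrightarrow> dioph_type x \<noteq> real m * \<bar>real m * x - of_int k\<bar>"
    and C: "C \<ge> 0"
  shows "(\<exists>m \<ge> 1. real m * \<bar>sin (real m * \<theta>)\<bar> \<le> C * cos (real m * \<theta>)) \<longleftrightarrow> 2 * pi * dioph_type x < C"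
    (is "?L \<longleftrightarrow> ?R")
proof
  assume ?L
  then obtain m where m: "m \<ge> 1" "real m * \<bar>sin (real m * \<theta>)\<bar> \<le> C * cos (real m * \<theta>)" by blast
  define k where "k = round (real m * x)"
  define \<phi> where "\<phi> = 2 * pi * (real m * x - of_int k)"
  have trig: "sin (real m * \<theta>) = sin \<phi>" "cos (real m * \<theta>) = cos \<phi>"
    unfolding \<phi>_def x_def by (rule sin_cos_shift)+
  have "\<bar>real m * x - of_int k\<bar> \<le> 1 / 2"
    using of_int_round_abs_le[of "real m * x"] by (simp add: k_def abs_minus_commute)
  then have \<phi>: "\<bar>\<phi>\<bar> \<le> pi"
    unfolding \<phi>_def by (simp add: abs_mult)
  \<comment> \<open>A zero of the sine would make \<open>2 * m * x\<close> an integer, and the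
    infimum would be attained with value 0 at the multiplier \<open>2 * m\<close>.\<close>
  have "sin (real m * \<theta>) \<noteq> 0"
  proof
    assume "sin (real m * \<theta>) = 0"
    then obtain j :: int where "real m * \<theta> = of_int j * pi"
      using sin_zero_iff_int2 by blast
    then have "real (2 * m) * x = of_int j" by (simp add: x_def field_simps)
    then have "dioph_type x \<le> 0" "dioph_type x \<noteq> 0"
      using dioph_type_le[of "2 * m" x j] not_att[of "2 * m" j] m(1) by auto
    then show False using dioph_type_nonneg[of x] by simp
  qed
  then have "real m * \<bar>sin \<phi>\<bar> > 0" using m(1) trig by simp
  then have "C * cos \<phi> > 0" using m(2) unfolding trig by linarith
  then have cpos: "cos \<phi> > 0" using C by (simp add: zero_less_mult_iff)
  have "\<bar>\<phi>\<bar> < pi / 2"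
  proof (rule ccontr)
    assume "\<not> \<bar>\<phi>\<bar> < pi / 2"
    then have "cos \<bar>\<phi>\<bar> \<le> cos (pi / 2)"
      using \<phi> by (intro cos_monotone_0_pi_le) auto
    then show False using cpos by simp
  qed
  then have "\<bar>\<phi>\<bar> \<le> tan \<bar>\<phi>\<bar>" by (intro le_tan) auto
  also have "tan \<bar>\<phi>\<bar> = \<bar>sin \<phi>\<bar> / cos \<phi>"
    using sin_ge_zero[of "\<bar>\<phi>\<bar>"] \<phi> by (cases "\<phi> \<ge> 0") (simp_all add: tan_def)
  finally have "\<bar>\<phi>\<bar> * cos \<phi> \<le> \<bar>sin \<phi>\<bar>" using cpos by (simp add: field_simps)
  then have "real m * (\<bar>\<phi>\<bar> * cos \<phi>) \<le> real m * \<bar>sin \<phi>\<bar>" by (rule mult_left_mono) simp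
  also have "\<dots> \<le> C * cos \<phi>" using m(2) trig by simp
  finally have "real m * \<bar>\<phi>\<bar> \<le> C"
    using cpos by (metis mult.assoc mult_le_cancel_right_pos)
  moreover have "dioph_type x < real m * \<bar>real m * x - of_int k\<bar>"
    using dioph_type_le[OF m(1), of x k] not_att[OF m(1), of k] by simp
  then have "2 * pi * dioph_type x < 2 * pi * (real m * \<bar>real m * x - of_int k\<bar>)" by simp
  moreover have "2 * pi * (real m * \<bar>real m * x - of_int k\<bar>) = real m * \<bar>\<phi>\<bar>"
    by (simp add: \<phi>_def abs_mult)
  ultimately show ?R by linarith
next
  assume R: ?R
  \<comment> \<open>\<open>C'\<close> is the midpoint of \<open>2 * pi * dioph_type x\<close> and
    \<open>C\<close>. It remains to find \<open>m\<close> with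
    \<open>m * \<bar>\<phi>\<bar> < C'\<close> and \<open>cos \<phi> \<ge> d\<close>; the threshold
    \<open>r\<close> is such that the first condition and \<open>m > r\<close> imply the
    second.\<close>
  define C' where "C' = (2 * pi * dioph_type x + C) / 2"
  have nn: "2 * pi * dioph_type x \<ge> 0" using dioph_type_nonneg by simp
  then have C': "0 < C'" "C' < C" "dioph_type x < C' / (2 * pi)"
    using R by (auto simp: C'_def field_simps)
  define d where "d = C' / C"
  define r where "r = C'\<^sup>2 / (2 * (1 - d))"
  obtain M :: nat where M: "r < real M" using reals_Archimedean2 by blast
  obtain m k where m: "m > M" "real m * \<bar>real m * x - of_int k\<bar> < C' / (2 * pi)"
    using dioph_type_not_attained_large[OF not_att C'(3)] by blast
  define \<phi> where "\<phi> = 2 * pi * (real m * x - of_int k)"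
  have trig: "sin (real m * \<theta>) = sin \<phi>" "cos (real m * \<theta>) = cos \<phi>"
    unfolding \<phi>_def x_def by (rule sin_cos_shift)+
  have "real m * \<bar>\<phi>\<bar> = 2 * pi * (real m * \<bar>real m * x - of_int k\<bar>)"
    by (simp add: \<phi>_def abs_mult)
  moreover have "2 * pi * (real m * \<bar>real m * x - of_int k\<bar>) < C'"
    using m(2) by (simp add: pos_less_divide_eq mult.commute)
  ultimately have m\<phi>: "real m * \<bar>\<phi>\<bar> < C'" by linarith
  have "(real m * \<bar>\<phi>\<bar>)\<^sup>2 \<le> C'\<^sup>2" using m\<phi> by (intro power_mono) auto
  then have "(real m)\<^sup>2 * \<phi>\<^sup>2 \<le> C'\<^sup>2" by (simp add: power_mult_distrib)
  moreover have "real m * \<phi>\<^sup>2 \<le> (real m)\<^sup>2 * \<phi>\<^sup>2"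
    using m(1) by (intro mult_right_mono) (auto simp: power2_eq_square)
  ultimately have 1: "real m * \<phi>\<^sup>2 \<le> C'\<^sup>2" by linarith
  have pos: "1 - d > 0" using C' by (simp add: d_def)
  have "C'\<^sup>2 < real M * (2 * (1 - d))"
    using M pos unfolding r_def by (subst (asm) pos_divide_less_eq) auto
  also have "\<dots> \<le> real m * (2 * (1 - d))"
    using m(1) pos by (intro mult_right_mono) auto
  finally have "real m * \<phi>\<^sup>2 < real m * (2 * (1 - d))" using 1 by linarith
  then have "\<phi>\<^sup>2 / 2 < 1 - d" using m(1) by simp
  then have "d \<le> cos \<phi>" using cos_ge_one_minus[of \<phi>] by linarith
  then have "C' \<le> C * cos \<phi>" using C' by (simp add: d_def field_simps)
  moreover have "real m * \<bar>sin \<phi>\<bar> \<le> real m * \<bar>\<phi>\<bar>"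
    by (intro mult_left_mono abs_sin_x_le_abs_x) auto
  ultimately have "real m * \<bar>sin \<phi>\<bar> \<le> C * cos \<phi>" using m\<phi> by linarith
  then show ?L using m(1) trig by (intro exI[of _ m]) auto
qed

section \<open>Counting completed turns by signs of the sine\<close>

lemma sin_two_pi_less_zero_iff: "sin (2 * pi * t) < 0 \<longleftrightarrow> frac t > 1 / 2"
proof -
  have "2 * pi * t = 2 * pi * frac t + 2 * pi * of_int \<lfloor>t\<rfloor>"
    by (simp add: frac_def algebra_simps)
  then have s: "sin (2 * pi * t) = sin (2 * pi * frac t)"
    by (simp add: sin_add sin_int_2pin cos_int_2pin)
  show ?thesis
  proof (cases "frac t > 1 / 2")
    case True
    then have "sin (2 * pi * frac t) < 0"
      using frac_lt_1[of t] by (intro sin_lt_zero) auto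
    then show ?thesis using s True by simp
  next
    case False
    then have "sin (2 * pi * frac t) \<ge> 0"
      by (intro sin_ge_zero) (auto simp: frac_ge_0)
    then show ?thesis using s False by simp
  qed
qed

text \<open>Each completed turn is seen as a passage of the sine from negative to nonnegative.\<close>

lemma floor_eq_sum_sign_changes:
  assumes "0 < y" "y < 1 / 2"
  shows "\<lfloor>real n * y\<rfloor> = int (\<Sum>i<n. if sin (2 * pi * (real i * y)) < 0 \<and>
    \<not> sin (2 * pi * (real (Suc i) * y)) < 0 then 1 else 0)"
proof (induction n)
  case (Suc n)
  let ?t = "real n * y"
  have y: "frac y = y" "\<lfloor>y\<rfloor> = 0" using assms by (auto simp: frac_eq floor_eq_iff)
  have t: "real (Suc n) * y = ?t + y" by (simp add: algebra_simps)
  \<comment> \<open>As \<open>y < 1 / 2\<close>, a step that passes an integer starts with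
    fractional part above \<open>1 / 2\<close> and ends below it, while any other step only
    increases the fractional part.\<close>
  have "\<lfloor>?t + y\<rfloor> = \<lfloor>?t\<rfloor> + (if frac ?t > 1 / 2 \<and> \<not> frac (?t + y) > 1 / 2 then 1 else 0)"
    unfolding frac_add floor_add y using assms frac_lt_1[of ?t] frac_ge_0[of ?t] by auto
  then show ?case
    unfolding sum.lessThan_Suc t using Suc by (simp add: sin_two_pi_less_zero_iff)
qed simp

subsection \<open>Computability of the approximation type\<close>

lemma complex_of_rat: "(of_rat r :: complex) = complex_of_real (of_rat r)"
  by (cases r) (simp add: of_rat_rat)

lemma cos_sin_rot:
  assumes "cis \<theta> = of_rat a + \<i> * of_rat b"
  shows "cos (real n * \<theta>) = of_rat (fst (rot a b n))" "sin (real n * \<theta>) = of_rat (snd (rot a b n))"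
proof -
  have "cis (real n * \<theta>) = of_rat (fst (rot a b n)) + \<i> * of_rat (snd (rot a b n))"
    by (simp only: Complex.DeMoivre[symmetric] assms rot_power)
  from arg_cong[OF this, of Re] arg_cong[OF this, of Im]
  show "cos (real n * \<theta>) = of_rat (fst (rot a b n))" "sin (real n * \<theta>) = of_rat (snd (rot a b n))"
    by (simp_all add: complex_of_rat)
qed

lemma cis_rat_norm:
  assumes "cis \<theta> = of_rat a + \<i> * of_rat b"
  shows "a\<^sup>2 + b\<^sup>2 = 1"
proof -
  have "cos \<theta> = of_rat a" "sin \<theta> = of_rat b"
    using assms by (simp_all add: complex_of_rat complex_eq_iff)
  then have "(of_rat (a\<^sup>2 + b\<^sup>2) :: real) = of_rat 1"
    using sin_cos_squared_add2[of \<theta>] by (simp add: of_rat_add of_rat_power)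
  then show ?thesis by (simp only: of_rat_eq_iff)
qed

text \<open>The two sequences \<open>n - p\<close> and \<open>p - n\<close> force the index of the positive entries to be \<open>p\<close>.\<close>

lemma recursive_sin_sign:
  assumes "simultaneous_positivity_decidable" and z: "cis \<theta> = of_rat a + \<i> * of_rat b"
  shows "\<exists>S. recursive 1 S \<and> (\<forall>p. S [p] = (if sin (real p * \<theta>) \<ge> 0 then 1 else 0))"
proof -
  define s where "s = (\<lambda>n. snd (rot a b n))"
  \<comment> \<open>With \<open>q = 1\<close> the three combinations are \<open>n - p\<close>,
    \<open>p - n\<close> and \<open>s n\<close>. The linear entries are spelled as
    \<open>\<alpha> * of_nat n + \<beta>\<close> to match
    \<open>satisfies_recurrence_linear\<close>.\<close>
  define uvs :: "((nat \<Rightarrow> rat) \<times> (nat \<Rightarrow> rat)) list" where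
    "uvs = [(\<lambda>n. 0 * of_nat n + (- 1), \<lambda>n. 1 * of_nat n + 0),
      (\<lambda>n. 0 * of_nat n + 1, \<lambda>n. (- 1) * of_nat n + 0), (\<lambda>n. 0 * of_nat n + 0, s)]"
  define cs where "cs = [2 * a + 2, - (4 * a + 2), 2 * a + 2, - 1]"
  have rec: "s (Suc (Suc n)) = 2 * a * s (Suc n) - s n" for n
    unfolding s_def by (rule rot_recurrence(2)[OF cis_rat_norm[OF z]])
  have "\<forall>(u, v)\<in>set uvs. satisfies_recurrence cs u \<and> satisfies_recurrence cs v"
    unfolding uvs_def cs_def
    by (simp only: list.set ball_simps prod.case satisfies_recurrence_linear[of s a, OF rec] simp_thms)
  then obtain D where D: "recursive 2 D" "\<And>p q. D [p, q] =
      (if \<exists>n. \<forall>(u, v)\<in>set uvs. of_nat p * u n + of_nat q * v n \<ge> 0 then 1 else 0)"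
    using recursive_positivity_query[OF assms(1), of cs uvs] by (auto simp: cs_def uvs_def)
  have "(\<exists>n. \<forall>(u, v)\<in>set uvs. of_nat p * u n + of_nat 1 * v n \<ge> 0) \<longleftrightarrow> sin (real p * \<theta>) \<ge> 0" for p
  proof -
    have "(\<exists>n. \<forall>(u, v)\<in>set uvs. of_nat p * u n + of_nat 1 * v n \<ge> 0) \<longleftrightarrow> s p \<ge> 0"
      unfolding uvs_def by (auto intro: order_antisym)
    also have "\<dots> \<longleftrightarrow> sin (real p * \<theta>) \<ge> 0"
      by (simp add: cos_sin_rot(2)[OF z] s_def)
    finally show ?thesis .
  qed
  then have "D [p, 1] = (if sin (real p * \<theta>) \<ge> 0 then 1 else 0)" for p
    unfolding D(2) by simp
  moreover have "recursive 1 (\<lambda>xs. D [xs ! 0, 1])"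
    by (intro recursive_comp2[OF D(1)] recursive_const recursive_arg)
  ultimately show ?thesis by (intro exI[of _ "\<lambda>xs. D [xs ! 0, 1]"]) auto
qed

text \<open>Strictly between the endpoints, the number of completed turns differs from
  \<open>n * y\<close> by less than 1. At \<open>\<theta> = pi\<close> every sine vanishes and sign
  changes would reveal nothing, so that value is handled directly.\<close>

lemma linearly_computable_angle:
  assumes "simultaneous_positivity_decidable" and z: "cis \<theta> = of_rat a + \<i> * of_rat b"
    and "0 \<le> \<theta>" "\<theta> \<le> pi"
  shows "linearly_computable (\<theta> / (2 * pi))"
proof -
  consider "\<theta> = 0" | "\<theta> = pi" | "0 < \<theta>" "\<theta> < pi" using assms(3,4) by linarith
  then show ?thesis
  proof cases
    case 1
    have "linearly_computable 0"
      by (rule linearly_computableI[of "\<lambda>_. 0" _ 0]) (auto intro: recursive_const)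
    then show ?thesis using 1 by simp
  next
    case 2
    then show ?thesis using linearly_computable_half by simp
  next
    case 3
    define y where "y = \<theta> / (2 * pi)"
    have y: "0 < y" "y < 1 / 2" using 3 by (auto simp: y_def field_simps)
    have \<theta>: "2 * pi * (real i * y) = real i * \<theta>" for i by (simp add: y_def)
    obtain S where S: "recursive 1 S" "\<And>p. S [p] = (if sin (real p * \<theta>) \<ge> 0 then 1 else 0)"
      using recursive_sin_sign[OF assms(1) z] by blast
    show ?thesis
      unfolding y_def[symmetric]
    proof (rule linearly_computableI)
      show "recursive 1 (\<lambda>xs. \<Sum>i<xs ! 0. (1 - S [i]) * S [Suc i])"
        by (intro recursive_sum recursive_mult recursive_diff recursive_const recursive_arg
            recursive_comp1[OF S(1)] recursive_Suc recursive_nth) simp_all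
      fix n
      have "(\<Sum>i<n. (1 - S [i]) * S [Suc i]) = (\<Sum>i<n. if sin (2 * pi * (real i * y)) < 0 \<and>
          \<not> sin (2 * pi * (real (Suc i) * y)) < 0 then 1 else 0)"
        unfolding \<theta> by (intro sum.cong refl) (auto simp: S(2))
      then have "int (\<Sum>i<n. (1 - S [i]) * S [Suc i]) = \<lfloor>real n * y\<rfloor>"
        using floor_eq_sum_sign_changes[OF y, of n] by simp
      then have "real (\<Sum>i<n. (1 - S [i]) * S [Suc i]) = of_int \<lfloor>real n * y\<rfloor>"
        by (metis of_int_of_nat_eq)
      then show "\<bar>real (\<Sum>i<n. (1 - S [i]) * S [Suc i]) - real n * y\<bar> \<le> 1"
        by linarith
    qed
  qed
qed

text \<open>The oracle answers whether \<open>T < p / q\<close>. For each \<open>q > 0\<close> the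
  least such \<open>p\<close> lies within 1 of \<open>q * T\<close>, which is linear precision for
  \<open>T\<close>.\<close>

lemma linearly_computable_dioph_type_not_attained:
  fixes \<theta> :: real
  defines "x \<equiv> \<theta> / (2 * pi)"
  assumes "simultaneous_positivity_decidable" and z: "cis \<theta> = of_rat a + \<i> * of_rat b"
    and not_att: "\<And>m k. m \<ge> 1 \<Longrightarrow> dioph_type x \<noteq> real m * \<bar>real m * x - of_int k\<bar>"
  shows "linearly_computable (dioph_type x)"
proof -
  define T where "T = 2 * pi * dioph_type x"
  have T0: "T \<ge> 0" using dioph_type_nonneg by (simp add: T_def)
  \<comment> \<open>The shift by \<open>Suc\<close> excludes the multiplier \<open>m = 0\<close>,
    which would satisfy the inequality for every nonnegative \<open>C\<close>.\<close>
  define u where "u = (\<lambda>n. fst (rot a b (Suc n)))"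
  define v where "v = (\<lambda>n. of_nat (Suc n) * snd (rot a b (Suc n)))"
  define cs where "cs = [4 * a, - (4 * a * a + 2), 4 * a, - 1]"
  \<comment> \<open>The two signs of \<open>v\<close> together express
    \<open>\<bar>q * v n\<bar> \<le> p * u n\<close>.\<close>
  define uvs :: "((nat \<Rightarrow> rat) \<times> (nat \<Rightarrow> rat)) list" where
    "uvs = [(u, v), (u, \<lambda>n. 0 * u n + (- 1) * v n)]"
  have "satisfies_recurrence cs u" "satisfies_recurrence cs v"
    unfolding cs_def u_def v_def
    using satisfies_recurrence_double(1)[of "\<lambda>n. fst (rot a b n)"]
      satisfies_recurrence_double(2)[of "\<lambda>n. snd (rot a b n)"] rot_recurrence[OF cis_rat_norm[OF z]]
    by blast+
  moreover from this have "satisfies_recurrence cs (\<lambda>n. 0 * u n + (- 1) * v n)"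
    by (rule satisfies_recurrence_combination)
  ultimately have "\<forall>(u, v)\<in>set uvs. satisfies_recurrence cs u \<and> satisfies_recurrence cs v"
    unfolding uvs_def by simp
  then obtain D where D: "recursive 2 D" "\<And>p q. D [p, q] =
      (if \<exists>n. \<forall>(u, v)\<in>set uvs. of_nat p * u n + of_nat q * v n \<ge> 0 then 1 else 0)"
    using recursive_positivity_query[OF assms(2), of cs uvs] by (auto simp: cs_def uvs_def)
  have query: "(\<exists>n. \<forall>(u, v)\<in>set uvs. of_nat p * u n + of_nat q * v n \<ge> 0) \<longleftrightarrow> T * real q < real p"
    if "q > 0" for p q
  proof -
    have pos_iff: "(of_nat p * u n + of_nat q * v n \<ge> 0 \<and> of_nat p * u n - of_nat q * v n \<ge> 0) \<longleftrightarrow>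
        real (Suc n) * \<bar>sin (real (Suc n) * \<theta>)\<bar> \<le> real p / real q * cos (real (Suc n) * \<theta>)" for n
    proof -
      define U V :: real where "U = of_rat (u n)" and "V = of_rat (v n)"
      have "(of_nat p * u n + of_nat q * v n \<ge> 0 \<and> of_nat p * u n - of_nat q * v n \<ge> 0) \<longleftrightarrow>
          (of_rat (of_nat p * u n + of_nat q * v n) \<ge> (0::real) \<and>
           of_rat (of_nat p * u n - of_nat q * v n) \<ge> (0::real))"
        by (simp only: zero_le_of_rat_iff)
      also have "\<dots> \<longleftrightarrow> real p * U + real q * V \<ge> 0 \<and> real p * U - real q * V \<ge> 0"
        by (simp add: U_def V_def of_rat_add of_rat_diff of_rat_mult)
      also have "\<dots> \<longleftrightarrow> \<bar>real q * V\<bar> \<le> real p * U" by linarith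
      also have "\<dots> \<longleftrightarrow> \<bar>V\<bar> \<le> real p / real q * U"
        using that by (simp add: abs_mult field_simps)
      also have "U = cos (real (Suc n) * \<theta>)"
        unfolding U_def u_def cos_sin_rot[OF z] ..
      also have "V = real (Suc n) * sin (real (Suc n) * \<theta>)"
        unfolding V_def v_def cos_sin_rot[OF z] of_rat_mult of_rat_of_nat_eq ..
      finally show ?thesis by (simp only: abs_mult abs_of_nat)
    qed
    have "(\<exists>n. \<forall>(u, v)\<in>set uvs. of_nat p * u n + of_nat q * v n \<ge> 0) \<longleftrightarrow>
        (\<exists>n. of_nat p * u n + of_nat q * v n \<ge> 0 \<and> of_nat p * u n - of_nat q * v n \<ge> 0)"
      by (simp add: uvs_def)
    also have "\<dots> \<longleftrightarrow>
        (\<exists>m \<ge> 1. real m * \<bar>sin (real m * \<theta>)\<bar> \<le> real p / real q * cos (real m * \<theta>))"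
      unfolding pos_iff by (metis One_nat_def Suc_le_D Suc_le_mono le0)
    also have "\<dots> \<longleftrightarrow> T < real p / real q"
      unfolding T_def x_def
      by (rule dioph_type_less_iff_sin_cos) (use not_att in \<open>auto simp: x_def\<close>)
    also have "\<dots> \<longleftrightarrow> T * real q < real p"
      using that by (simp add: pos_less_divide_eq)
    finally show ?thesis .
  qed
  \<comment> \<open>Minimization searches for a zero, so the 0-1 answer is flipped.\<close>
  have D_eq: "1 - D [p, q] = 0 \<longleftrightarrow> T * real q < real p" if "q > 0" for p q
    unfolding D(2) query[OF that] by simp
  have ex: "\<exists>p. 1 - D [p, q] = 0" for q
  proof (cases "q = 0")
    case True
    \<comment> \<open>For \<open>p = q = 0\<close> the query only asks for \<open>0 \<ge> 0\<close>,
      so the search also terminates at \<open>q = 0\<close>.\<close>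
    have "1 - D [0, q] = 0" unfolding D(2) True by simp
    then show ?thesis by blast
  next
    case False
    obtain p :: nat where "T * real q < real p" using reals_Archimedean2 by blast
    then show ?thesis using D_eq[of q p] False by auto
  qed
  have "linearly_computable T"
  proof (rule linearly_computableI)
    show "recursive 1 (\<lambda>xs. LEAST p. 1 - D [p, xs ! 0] = 0)"
    proof (rule recursive_Least)
      show "recursive (Suc 1) (\<lambda>ys. 1 - D [ys ! 0, tl ys ! 0])"
        by (intro recursive_diff recursive_comp2[OF D(1)] recursive_const recursive_tl
            recursive_arg recursive_nth) simp
    qed (rule ex)
    fix q
    define p where "p = (LEAST p. 1 - D [p, q] = 0)"
    have "1 - D [p, q] = 0" unfolding p_def using ex[of q] by (rule LeastI_ex)
    moreover have least: "1 - D [p', q] \<noteq> 0" if "p' < p" for p'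
      using that unfolding p_def by (rule not_less_Least)
    ultimately show "\<bar>real p - real q * T\<bar> \<le> 1"
    proof (cases "q = 0")
      case True
      have "1 - D [0, q] = 0" unfolding D(2) True by simp
      then have "p = 0" using least[of 0] by auto
      then show ?thesis using True by simp
    next
      case False
      assume "1 - D [p, q] = 0"
      then have p: "T * real q < real p" using D_eq False by simp
      then have "p > 0" using T0 by (metis gr0I mult_nonneg_nonneg not_less of_nat_0 of_nat_0_le_iff)
      \<comment> \<open>Minimality of \<open>p\<close> bounds the overshoot by 1; positivity of
        \<open>p\<close>, which comes from \<open>T \<ge> 0\<close>, makes \<open>p - 1\<close> a
        true predecessor.\<close>
      then have "\<not> T * real q < real (p - 1)"
        using least[of "p - 1"] D_eq[of q "p - 1"] False by simp
      then show ?thesis using p \<open>p > 0\<close> by (simp add: of_nat_diff mult.commute)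
    qed
  qed
  moreover have "linearly_computable (2 * pi)"
    using linearly_computable_abs_affine[OF linearly_computable_pi, of 2 0] by simp
  ultimately have "linearly_computable (T / (2 * pi))"
    by (rule linearly_computable_divide) simp
  then show ?thesis by (simp add: T_def)
qed

lemma linearly_computable_dioph_type:
  assumes "simultaneous_positivity_decidable" and z: "cis \<theta> = of_rat a + \<i> * of_rat b"
    and "0 \<le> \<theta>" "\<theta> \<le> pi"
  shows "linearly_computable (dioph_type (\<theta> / (2 * pi)))"
proof (cases "\<exists>m \<ge> 1. \<exists>k. dioph_type (\<theta> / (2 * pi)) = real m * \<bar>real m * (\<theta> / (2 * pi)) - of_int k\<bar>")
  case True
  then obtain m k where "dioph_type (\<theta> / (2 * pi)) = real m * \<bar>real m * (\<theta> / (2 * pi)) - of_int k\<bar>"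
    by blast
  \<comment> \<open>Written as two nested absolute affine maps, with offsets \<open>- k\<close> and
    then \<open>0\<close>.\<close>
  also have "\<dots> = \<bar>real m * \<bar>real m * (\<theta> / (2 * pi)) + of_int (- k)\<bar> + of_int 0\<bar>" by simp
  finally show ?thesis
    using linearly_computable_abs_affine[OF linearly_computable_abs_affine[OF linearly_computable_angle[OF assms]],
        of m m "- k" 0] by (simp only:)
next
  case False
  then show ?thesis
    by (intro linearly_computable_dioph_type_not_attained[OF assms(1) z]) blast
qed

theorem theorem4:
  fixes z :: complex
  assumes "simultaneous_positivity_decidable"
    and "z \<in> gaussian_rationals" and "cmod z = 1"
  shows "computable_real (dioph_type (Arg z / (2 * pi)))"
proof -
  obtain a b where z: "z = of_rat a + \<i> * of_rat b"
    using assms(2) unfolding gaussian_rationals_def by blast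
  have "z \<noteq> 0" using assms(3) by auto
  then have cis: "cis (Arg z) = z" using assms(3) by (simp add: cis_Arg sgn_div_norm)
  \<comment> \<open>Points of the lower half-plane are reflected by conjugation, which keeps
    \<open>a\<close>, negates \<open>b\<close>, and preserves the approximation type.\<close>
  define \<theta> where "\<theta> = \<bar>Arg z\<bar>"
  have "\<exists>b'. cis \<theta> = of_rat a + \<i> * of_rat b'"
  proof (cases "Arg z \<ge> 0")
    case True
    then show ?thesis using cis z by (auto simp: \<theta>_def)
  next
    case False
    then have "cis \<theta> = cnj z" using cis by (metis \<theta>_def abs_of_neg cis_cnj not_le)
    then have "cis \<theta> = of_rat a + \<i> * of_rat (- b)"
      by (simp add: z complex_of_rat of_rat_minus)
    then show ?thesis by blast
  qed
  then obtain b' where "cis \<theta> = of_rat a + \<i> * of_rat b'" ..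
  moreover have "0 \<le> \<theta>" "\<theta> \<le> pi"
    using Arg_bounded[of z] by (auto simp: \<theta>_def)
  ultimately have "linearly_computable (dioph_type (\<theta> / (2 * pi)))"
    using linearly_computable_dioph_type[OF assms(1)] by blast
  moreover have "dioph_type (\<theta> / (2 * pi)) = dioph_type (Arg z / (2 * pi))"
    using dioph_type_minus[of "Arg z / (2 * pi)"] by (cases "Arg z \<ge> 0") (simp_all add: \<theta>_def)
  ultimately show ?thesis by (simp add: linearly_computable_imp_computable_real)
qed

end
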